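(* Let $n,r$ be positive integers with $n\ge r$. Let $V=\mathbb{C}^n$, $\underline{V}=V\oplus\mathbb{C}\eta\cong\mathbb{C}^{n+1}$, $G=\mathrm{GL}(V)$, and let $\underline{G}\rtimes\mathbf{G}_m\subseteq\mathrm{GL}(\underline{V})$ be the associated parabolic subgroup, acting diagonally on $\underline{V}^{\otimes r}$. Then $$D(n,r)^V=\mathbb{C}\Psi(\mathfrak{S}_r),\qquad\text{i.e.}\qquad \mathrm{End}_{\underline{G}\rtimes\mathbf{G}_m}(\underline{V}^{\otimes r})=\mathbb{C}\Psi(\mathfrak{S}_r).$$
   Context: All vector spaces are over $\mathbb{C}$. Groups: $V$ is $n$-dimensional, $\underline{V}=V\oplus\mathbb{C}\eta$, $G=\mathrm{GL}(V)\cong\mathrm{GL}_n$. The enhanced group is $\underline{G}=G\ltimes V$, i.e. the set $G\times V$ with product $(g_1,v_1)(g_2,v_2)=(g_1g_2,\,g_1v_2+v_1)$; it acts faithfully on $\underline{V}$ by $(g,v)\cdot(u+a\eta)=g(u)+av+a\eta$ ($u\in V$, $a\in\mathbb{C}$), and so is regarded as a subgroup of $\mathrm{GL}(\underline{V})$. For $v\in V$ write $e^v:=(1_G,v)$, so $e^v(u+a\eta)=u+av+a\eta$. The group $\mathbf{G}_m=\mathbb{C}^\times$ is embedded in $\mathrm{GL}(\underline{V})$ with $c$ acting as the identity on $V$ and by $\eta\mapsto c\eta$. Then $\underline{G}\rtimes\mathbf{G}_m$ denotes the subgroup of $\mathrm{GL}(\underline{V})$ generated by $\underline{G}$ and $\mathbf{G}_m$;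 it is the parabolic subgroup of all elements of $\mathrm{GL}(\underline{V})$ that stabilize $V$. Actions: $\Phi$ is the diagonal action of $\mathrm{GL}(\underline{V})$ on $\underline{V}^{\otimes r}$, $\Phi(g)(v_1\otimes\cdots\otimes v_r)=gv_1\otimes\cdots\otimes gv_r$. $\Psi$ is the action of $\mathfrak{S}_r$ on $\underline{V}^{\otimes r}$, $\Psi(\sigma)(v_1\otimes\cdots\otimes v_r)=v_{\sigma^{-1}(1)}\otimes\cdots\otimes v_{\sigma^{-1}(r)}$. $\mathbb{C}\Psi(\mathfrak{S}_r)$ is the subalgebra of $\mathrm{End}_{\mathbb{C}}(\underline{V}^{\otimes r})$ generated by $\Psi(\mathfrak{S}_r)$. For a subgroup $H\subseteq\mathrm{GL}(\underline{V})$, $\mathrm{End}_H(\underline{V}^{\otimes r})$ is the algebra of endomorphisms commuting with $\Phi(h)$ for all $h\in H$. Decomposition: write $\underline{m}=\{1,\dots,m\}$ (with $\underline{0}=\emptyset$). For $I\subseteq\underline{r}$ let $\underline{V}_I^{\otimes r}=V_1\otimes\cdots\otimes V_r\subseteq\underline{V}^{\otimes r}$ with $V_i=V$ if $i\in I$ and $V_i=\mathbb{C}\eta$ if $i\notin I$. Thus $\underline{V}^{\otimes r}=\bigoplus_{I\subseteq\underline{r}}\underline{V}_I^{\otimes r}$. The algebra $D(n,r)$: for $I=\{i_1<\cdots<i_l\}\subseteq\underline{r}$ and $\sigma\in\mathfrak{S}_l$, let $x_\sigma^I\in\mathrm{End}_{\mathbb{C}}(\underline{V}^{\otimes r})$ be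 the endomorphism that sends $v_1\otimes\cdots\otimes v_r\in\underline{V}_I^{\otimes r}$ to $w_1\otimes\cdots\otimes w_r$, where $w_{i_k}=v_{i_{\sigma^{-1}(k)}}$ for $1\le k\le l$ and $w_j=v_j$ for $j\notin I$, and that is zero on $\underline{V}_J^{\otimes r}$ for every $J\neq I$. Then $D(n,r)$ (the finite-dimensional degenerate double Hecke algebra) is the subalgebra of $\mathrm{End}_{\mathbb{C}}(\underline{V}^{\otimes r})$ generated by $\Psi(\mathfrak{S}_r)$ and all $x_\sigma^{\underline{l}}$ with $0\le l\le r$, $\sigma\in\mathfrak{S}_l$ (equivalently, the image of the degenerate double Hecke algebra of $\mathfrak{S}_r$ under its representation on $\underline{V}^{\otimes r}$). Finally $$D(n,r)^V=\{\phi\in D(n,r)\mid \Phi(e^v)\circ\phi=\phi\circ\Phi(e^v)\ \text{for all } v\in V\}.$$ *)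

theory Defs
  imports
    "HOL-Analysis.Analysis"
    "HOL-Combinatorics.Permutations"
    "HOL-Algebra.Generated_Groups"
begin

unbundle no m_inv_syntax

section \<open>The enhanced group\<close>

text \<open>
  \<open>V\<close> is \<open>complex ^ 'n\<close>, and the enhanced space is \<open>complex ^ 'n option\<close>: the index
  \<open>Some j\<close> belongs to the \<open>j\<close>-th coordinate of \<open>V\<close>, the index \<open>None\<close> to that of \<open>\<eta>\<close>.
\<close>

abbreviation clinear :: "(complex ^ 'a \<Rightarrow> complex ^ 'b) \<Rightarrow> bool"
  where "clinear \<equiv> Vector_Spaces.linear (*s) (*s)"

definition GL :: "(complex ^ 'm \<Rightarrow> complex ^ 'm) monoid"
  where "GL = \<lparr>carrier = {g. clinear g \<and> bij g}, mult = (\<circ>), one = id\<rparr>"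

definition emb :: "complex ^ ('n :: finite) \<Rightarrow> complex ^ 'n option"
  where "emb u = (\<chi> k. case k of Some j \<Rightarrow> u $ j | None \<Rightarrow> 0)"

definition eta :: "complex ^ ('n :: finite) option"
  where "eta = axis None 1"

definition V_part :: "complex ^ ('n :: finite) option \<Rightarrow> complex ^ 'n"
  where "V_part w = (\<chi> j. w $ Some j)"

definition eta_part :: "complex ^ ('n :: finite) option \<Rightarrow> complex"
  where "eta_part w = w $ None"

definition enh :: "(complex ^ ('n :: finite) \<Rightarrow> complex ^ 'n) \<Rightarrow> complex ^ 'n
    \<Rightarrow> complex ^ 'n option \<Rightarrow> complex ^ 'n option"
  where "enh g v w = emb (g (V_part w) + eta_part w *s v) + eta_part w *s eta"

definition e_pow :: "complex ^ ('n :: finite) \<Rightarrow> complex ^ 'n option \<Rightarrow> complex ^ 'n option"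
  where "e_pow v = enh id v"

definition scale_eta :: "complex \<Rightarrow> complex ^ ('n :: finite) option \<Rightarrow> complex ^ 'n option"
  where "scale_eta c w = emb (V_part w) + (c * eta_part w) *s eta"

definition enhanced_group :: "(complex ^ ('n :: finite) option \<Rightarrow> complex ^ 'n option) set"
  where "enhanced_group = {enh g v | g v. g \<in> carrier GL}"

definition Gm :: "(complex ^ ('n :: finite) option \<Rightarrow> complex ^ 'n option) set"
  where "Gm = {scale_eta c | c. c \<noteq> 0}"

definition enhanced_Gm :: "(complex ^ ('n :: finite) option \<Rightarrow> complex ^ 'n option) set"
  where "enhanced_Gm = generate GL (enhanced_group \<union> Gm)"

lemma mem_GL_iff: "g \<in> carrier GL \<longleftrightarrow> clinear g \<and> bij g"
  by (simp add: GL_def)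

lemma mult_GL: "g \<otimes>\<^bsub>GL\<^esub> h = g \<circ> h"
  by (simp add: GL_def)

lemma one_GL: "\<one>\<^bsub>GL\<^esub> = id"
  by (simp add: GL_def)

lemma clinear_iff:
  "clinear f \<longleftrightarrow> (\<forall>x y. f (x + y) = f x + f y) \<and> (\<forall>c x. f (c *s x) = c *s f x)"
  by (simp add: Vector_Spaces.linear_iff vec.vector_space_axioms)

lemma group_GL: "group (GL :: (complex ^ 'm \<Rightarrow> complex ^ 'm) monoid)"
proof (rule groupI)
  fix x y :: "complex ^ 'm \<Rightarrow> complex ^ 'm"
  assume "x \<in> carrier GL" "y \<in> carrier GL"
  then show "x \<otimes>\<^bsub>GL\<^esub> y \<in> carrier GL"
    by (auto simp: mem_GL_iff mult_GL clinear_iff bij_comp)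
next
  fix x :: "complex ^ 'm \<Rightarrow> complex ^ 'm"
  assume x: "x \<in> carrier GL"
  have "clinear (inv x)"
    unfolding clinear_iff
  proof safe
    fix a b c
    have s: "x (inv x z) = z" and i: "inv x (x z) = z" for z
      using x by (simp_all add: mem_GL_iff bij_is_surj surj_f_inv_f bij_is_inj)
    have l: "x (p + q) = x p + x q" "x (c *s p) = c *s x p" for p q
      using x by (simp_all add: mem_GL_iff clinear_iff)
    show "inv x (a + b) = inv x a + inv x b"
      by (metis s i l(1))
    show "inv x (c *s a) = c *s inv x a"
      by (metis s i l(2))
  qed
  then show "\<exists>y\<in>carrier GL. y \<otimes>\<^bsub>GL\<^esub> x = \<one>\<^bsub>GL\<^esub>"
    using x by (intro bexI[of _ "inv x"])
      (auto simp: mem_GL_iff mult_GL one_GL bij_imp_bij_inv bij_is_inj)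
qed (auto simp: mem_GL_iff mult_GL one_GL clinear_iff comp_assoc)

lemma emb_V_part [simp]: "V_part (emb u + a *s eta) = u" "eta_part (emb u + a *s eta) = a"
  by (simp_all add: V_part_def eta_part_def emb_def eta_def vec_eq_iff axis_def)

lemma decomp: "w = emb (V_part w) + eta_part w *s eta"
  by (simp add: vec_eq_iff V_part_def eta_part_def emb_def eta_def axis_def split: option.split)

lemma emb_linear: "emb (u + v) = emb u + emb v" "emb (c *s u) = c *s emb u"
  by (simp_all add: vec_eq_iff emb_def split: option.split)

lemma parts_linear:
  "V_part (x + y) = V_part x + V_part y" "V_part (c *s x) = c *s V_part x"
  "eta_part (x + y) = eta_part x + eta_part y" "eta_part (c *s x) = c * eta_part x"
  by (simp_all add: vec_eq_iff V_part_def eta_part_def)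

lemma enh_apply: "enh g v (emb u + a *s eta) = emb (g u) + a *s emb v + a *s eta"
  by (simp add: enh_def emb_linear)

lemma e_pow_apply: "e_pow v (emb u + a *s eta) = emb u + a *s emb v + a *s eta"
  by (simp add: e_pow_def enh_apply)

lemma scale_eta_apply: "scale_eta c (emb u + a *s eta) = emb u + a *s (c *s eta)"
  by (simp add: scale_eta_def vec.scale_scale mult.commute)

lemma enh_comp:
  assumes "g \<in> carrier GL"
  shows "enh g v \<circ> enh h w = enh (g \<circ> h) (g w + v)"
proof
  fix x
  have "g (p + q) = g p + g q" "g (c *s p) = c *s g p" for p q c
    using assms by (simp_all add: mem_GL_iff clinear_iff)
  then show "(enh g v \<circ> enh h w) x = enh (g \<circ> h) (g w + v) x"
    by (simp add: enh_def vec.scale_right_distrib add.assoc)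
qed

lemma enh_in_GL:
  assumes "g \<in> carrier GL"
  shows "enh g v \<in> carrier GL"
proof -
  have lg: "g (p + q) = g p + g q" "g (c *s p) = c *s g p" for p q c
    using assms by (simp_all add: mem_GL_iff clinear_iff)
  have lin: "clinear (enh g v)"
    unfolding clinear_iff
    by (simp add: enh_def parts_linear lg emb_linear vec.scale_right_distrib
        vec.scale_left_distrib add_ac)
  have id: "enh id 0 = id"
    by (rule ext) (simp add: enh_def decomp[symmetric])
  interpret group "GL :: (complex ^ 'a \<Rightarrow> complex ^ 'a) monoid" by (rule group_GL)
  obtain h where h: "h \<in> carrier GL" "h \<circ> g = id" "g \<circ> h = id"
    using assms r_inv[OF assms] l_inv[OF assms] inv_closed[OF assms]
    by (metis mult_GL one_GL)
  have lh: "h (p + q) = h p + h q" "h (c *s p) = c *s h p" for p q c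
    using h(1) by (simp_all add: mem_GL_iff clinear_iff)
  have z: "h (- v) + h v = 0"
    using lh(1)[of "- v" v] lh(2)[of 0 v] by simp
  have "g (h (- v)) = - v"
    using h(3) by (metis comp_apply id_apply)
  then have "enh g v \<circ> enh h (h (- v)) = id" "enh h (h (- v)) \<circ> enh g v = id"
    using z by (simp_all add: enh_comp assms h id add.commute)
  then have "bij (enh g v)"
    by (metis o_bij)
  with lin show ?thesis by (simp add: mem_GL_iff)
qed

lemma scale_eta_in_GL:
  assumes "c \<noteq> 0"
  shows "scale_eta c \<in> carrier GL"
proof -
  have lin: "clinear (scale_eta c)"
    unfolding clinear_iff
    by (simp add: scale_eta_def parts_linear emb_linear vec.scale_right_distrib
        vec.scale_left_distrib algebra_simps)
  have "scale_eta c \<circ> scale_eta (inverse c) = id" "scale_eta (inverse c) \<circ> scale_eta c = id"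
    using assms by (auto simp: fun_eq_iff scale_eta_def mult.assoc[symmetric] decomp[symmetric])
  then have "bij (scale_eta c)"
    by (metis o_bij)
  with lin show ?thesis by (simp add: mem_GL_iff)
qed

lemma enhanced_Gm_eq_parabolic:
  "enhanced_Gm = {h \<in> carrier GL. h ` range emb = range emb}"
proof -
  have V: "x \<in> range emb \<longleftrightarrow> eta_part x = 0" for x :: "complex ^ 'a option"
  proof
    show "x \<in> range emb \<Longrightarrow> eta_part x = 0"
      by (auto simp: emb_def eta_part_def)
    show "eta_part x = 0 \<Longrightarrow> x \<in> range emb"
      using decomp[of x] by (metis add.right_neutral rangeI vec.scale_zero_left)
  qed
  have A: "h \<in> {h \<in> carrier GL. h ` range emb = range emb}" if "h \<in> enhanced_Gm"
    for h :: "complex ^ 'a option \<Rightarrow> complex ^ 'a option"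
  proof -
    interpret group "GL :: (complex ^ 'a option \<Rightarrow> _) monoid" by (rule group_GL)
    have st: "subgroup {h \<in> carrier GL. h ` range emb = range emb}
        (GL :: (complex ^ 'a option \<Rightarrow> _) monoid)"
    proof (rule subgroupI)
      fix a :: "complex ^ 'a option \<Rightarrow> complex ^ 'a option"
      assume a: "a \<in> {h \<in> carrier GL. h ` range emb = range emb}"
      then have "m_inv GL a \<circ> a = id"
        using l_inv[of a] by (simp add: mult_GL one_GL)
      then have "(m_inv GL a) ` (a ` range emb) = range emb"
        by (metis image_comp image_id id_apply)
      with a show "m_inv GL a \<in> {h \<in> carrier GL. h ` range emb = range emb}"
        by simp
    next
      fix a b :: "complex ^ 'a option \<Rightarrow> complex ^ 'a option"
      assume ab: "a \<in> {h \<in> carrier GL. h ` range emb = range emb}"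
        "b \<in> {h \<in> carrier GL. h ` range emb = range emb}"
      then have "a \<otimes>\<^bsub>GL\<^esub> b \<in> carrier GL" by simp
      moreover have "(a \<circ> b) ` range emb = range emb"
        using ab by (metis (mono_tags, lifting) image_comp mem_Collect_eq)
      ultimately show "a \<otimes>\<^bsub>GL\<^esub> b \<in> {h \<in> carrier GL. h ` range emb = range emb}"
        by (simp add: mult_GL)
    next
      have "id \<in> {h \<in> carrier GL. h ` range emb = range emb}"
        by (simp add: mem_GL_iff clinear_iff)
      then show "{h \<in> carrier GL. h ` range emb = range emb} \<noteq> {}" by blast
    qed auto
    have img: "k ` range emb = range emb"
      if "bij k" "\<And>x. eta_part (k x) = 0 \<longleftrightarrow> eta_part x = 0" for k :: "complex ^ 'a option \<Rightarrow> complex ^ 'a option"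
    proof -
      have R: "range emb = Collect (\<lambda>x :: complex ^ 'a option. eta_part x = 0)"
        using V by blast
      have "y \<in> k ` Collect (\<lambda>x. eta_part x = 0)" if y: "eta_part y = 0" for y
      proof -
        obtain x where "y = k x" using \<open>bij k\<close> by (metis bij_pointE)
        with y \<open>\<And>x. eta_part (k x) = 0 \<longleftrightarrow> eta_part x = 0\<close> show ?thesis by simp
      qed
      then have "Collect (\<lambda>x. eta_part x = 0) \<subseteq> k ` Collect (\<lambda>x. eta_part x = 0)"
        by (intro subsetI) simp
      moreover have "k ` Collect (\<lambda>x. eta_part x = 0) \<subseteq> Collect (\<lambda>x. eta_part x = 0)"
        using that(2) by auto
      ultimately show ?thesis
        unfolding R by (rule equalityI[rotated])
    qed
    have "enh g v ` range emb = range emb" if "g \<in> carrier GL"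
      for g :: "complex ^ 'a \<Rightarrow> complex ^ 'a" and v
      using enh_in_GL[OF that] by (intro img) (auto simp: mem_GL_iff enh_def)
    moreover have "scale_eta c ` range emb = (range emb :: (complex ^ 'a option) set)" if "c \<noteq> 0" for c
      using scale_eta_in_GL[OF that] that by (intro img) (auto simp: mem_GL_iff scale_eta_def)
    ultimately have "enhanced_group \<union> Gm \<subseteq>
        {h :: complex ^ 'a option \<Rightarrow> complex ^ 'a option. h \<in> carrier GL \<and> h ` range emb = range emb}"
      using enh_in_GL scale_eta_in_GL unfolding enhanced_group_def Gm_def
      by (intro Un_least subsetI; elim CollectE exE conjE; simp)
    from generate_subgroup_incl[OF this st] \<open>h \<in> enhanced_Gm\<close>
    show "h \<in> {h \<in> carrier GL. h ` range emb = range emb}"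
      unfolding enhanced_Gm_def by blast
  qed
  have B: "h \<in> enhanced_Gm" if h: "h \<in> {h \<in> carrier GL. h ` range emb = range emb}"
    for h :: "complex ^ 'a option \<Rightarrow> complex ^ 'a option"
  proof -
    from h have lh: "h (p + q) = h p + h q" "h (c *s p) = c *s h p" for p q c
      by (simp_all add: mem_GL_iff clinear_iff)
    have bij: "bij h" and im: "h ` range emb = range emb"
      using h by (auto simp: mem_GL_iff)
    define g where "g u = V_part (h (emb u))" for u
    have hg: "h (emb u) = emb (g u)" for u
    proof -
      have "h (emb u) \<in> range emb" using im by blast
      then show ?thesis
        using decomp[of "h (emb u)"] V by (simp add: g_def)
    qed
    have inj_emb: "inj emb"
      by (metis (no_types, lifting) add.right_neutral emb_V_part(1) injI vec.scale_zero_left)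
    have "clinear g"
      unfolding clinear_iff by (simp add: g_def emb_linear lh parts_linear)
    moreover have "inj g"
      by (metis bij bij_def hg inj_emb inj_def)
    moreover have "surj g"
    proof -
      have "\<exists>u. g u = y" for y
      proof -
        have "emb y \<in> h ` range emb" using im by auto
        then obtain u where "emb y = emb (g u)"
          using hg by auto
        then show ?thesis
          using inj_emb by (metis injD)
      qed
      then show ?thesis by (metis surjI)
    qed
    ultimately have gGL: "g \<in> carrier GL" by (simp add: mem_GL_iff bij_def)
    define c where "c = eta_part (h eta)"
    have c0: "c \<noteq> 0"
    proof
      assume "c = 0"
      then have "h eta \<in> h ` range emb" using V im by (simp add: c_def)
      then have "(eta :: complex ^ 'a option) \<in> range emb"
        using bij by (simp add: bij_is_inj inj_image_mem_iff)
      then show False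
        using V[of eta] by (simp add: eta_part_def eta_def)
    qed
    define v where "v = inverse c *s V_part (h eta)"
    have "h x = (enh g v \<circ> scale_eta c) x" for x
    proof -
      have "h x = h (emb (V_part x)) + eta_part x *s h eta"
        using decomp[of x] lh by metis
      also have "h eta = emb (c *s v) + c *s eta"
        using decomp[of "h eta"] c0 by (simp add: v_def c_def)
      finally show ?thesis
        by (simp add: hg enh_def scale_eta_def emb_linear vec.scale_right_distrib mult.commute
            add.assoc)
    qed
    then have "h = enh g v \<otimes>\<^bsub>GL\<^esub> scale_eta c"
      by (auto simp: mult_GL)
    moreover have "enh g v \<in> enhanced_Gm" "scale_eta c \<in> enhanced_Gm"
      using gGL c0 unfolding enhanced_Gm_def enhanced_group_def Gm_def
      by (auto intro!: generate.incl)
    ultimately show "h \<in> enhanced_Gm"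
      unfolding enhanced_Gm_def by (metis generate.eng)
  qed
  show ?thesis
    by (rule equalityI; rule subsetI) (erule A, erule B)
qed


section \<open>The tensor power\<close>

text \<open>
  The tensor positions \<open>1, \<dots>, r\<close> are the elements of a finite linearly ordered type \<open>'r\<close>,
  so \<open>r = CARD('r)\<close>. The \<open>r\<close>-th tensor power of the enhanced space is the coordinate space
  on the multi-indices \<open>'r \<Rightarrow> 'n option\<close>, i.e. on its basis of pure tensors of basis vectors.
\<close>

type_synonym ('n, 'r) tensor = "complex ^ ('r \<Rightarrow> 'n option)"

definition pure_tensor :: "('r :: finite \<Rightarrow> complex ^ 'n option) \<Rightarrow> ('n :: finite, 'r) tensor"
  where "pure_tensor v = (\<chi> k. \<Prod>i\<in>UNIV. v i $ k i)"

definition basis_at :: "('r \<Rightarrow> ('n :: finite) option) \<Rightarrow> 'r \<Rightarrow> complex ^ 'n option"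
  where "basis_at k i = axis (k i) 1"

text \<open>The linear map that sends the basis tensor \<open>pure_tensor (basis_at k)\<close> to \<open>F k\<close>.\<close>

definition lin_ext :: "(('r :: finite \<Rightarrow> 'n :: finite option) \<Rightarrow> ('n, 'r) tensor)
    \<Rightarrow> ('n, 'r) tensor \<Rightarrow> ('n, 'r) tensor"
  where "lin_ext F t = (\<Sum>k\<in>UNIV. t $ k *s F k)"

definition Phi :: "(complex ^ 'n option \<Rightarrow> complex ^ 'n option)
    \<Rightarrow> ('n :: finite, 'r :: finite) tensor \<Rightarrow> ('n, 'r) tensor"
  where "Phi g = lin_ext (\<lambda>k. pure_tensor (\<lambda>i. g (basis_at k i)))"

definition Psi :: "('r \<Rightarrow> 'r) \<Rightarrow> ('n :: finite, 'r :: finite) tensor \<Rightarrow> ('n, 'r) tensor"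
  where "Psi \<sigma> = lin_ext (\<lambda>k. pure_tensor (\<lambda>i. basis_at k (inv \<sigma> i)))"

definition homog :: "'r set \<Rightarrow> ('n :: finite, 'r :: finite) tensor set"
  where "homog I = vec.span {pure_tensor v | v.
    (\<forall>i\<in>I. v i \<in> range emb) \<and> (\<forall>i\<in>-I. v i \<in> range (\<lambda>a. a *s eta))}"

text \<open>
  Here \<open>\<tau>\<close> is a permutation of \<open>I\<close> itself. A permutation \<open>\<sigma>\<close> of \<open>{1..l}\<close>, \<open>l = card I\<close>,
  corresponds to \<open>\<tau> i\<^sub>k = i\<^bsub>\<sigma>(k)\<^esub>\<close> where \<open>I = {i\<^sub>1 < \<dots> < i\<^sub>l}\<close>; for \<open>I\<close> the first \<open>l\<close> positions,
  \<open>\<tau>\<close> and \<open>\<sigma>\<close> are the same.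
\<close>

definition x_op :: "'r set \<Rightarrow> ('r \<Rightarrow> 'r) \<Rightarrow> ('n :: finite, 'r :: finite) tensor \<Rightarrow> ('n, 'r) tensor"
  where "x_op I \<tau> = lin_ext (\<lambda>k.
    if {i. k i \<noteq> None} = I then pure_tensor (\<lambda>i. basis_at k (inv \<tau> i)) else 0)"

text \<open>\<open>card {..i}\<close> is the number in \<open>{1..CARD('r)}\<close> of the position \<open>i\<close>.\<close>

definition first_positions :: "nat \<Rightarrow> 'r :: {finite, linorder} set"
  where "first_positions l = {i. card {..i} \<le> l}"

definition subalg_End :: "(('n :: finite, 'r :: finite) tensor \<Rightarrow> ('n, 'r) tensor) set \<Rightarrow> bool"
  where "subalg_End A \<longleftrightarrow> A \<subseteq> {\<phi>. clinear \<phi>} \<and> id \<in> A \<and>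
    (\<forall>\<phi>\<in>A. \<forall>\<psi>\<in>A. (\<lambda>t. \<phi> t + \<psi> t) \<in> A) \<and>
    (\<forall>c. \<forall>\<phi>\<in>A. (\<lambda>t. c *s \<phi> t) \<in> A) \<and>
    (\<forall>\<phi>\<in>A. \<forall>\<psi>\<in>A. \<phi> \<circ> \<psi> \<in> A)"

definition C_Psi :: "(('n :: finite, 'r :: finite) tensor \<Rightarrow> ('n, 'r) tensor) set"
  where "C_Psi = subalg_End hull {Psi \<sigma> | \<sigma>. \<sigma> permutes UNIV}"

definition D_alg :: "(('n :: finite, 'r :: {finite, linorder}) tensor \<Rightarrow> ('n, 'r) tensor) set"
  where "D_alg = subalg_End hull ({Psi \<sigma> | \<sigma>. \<sigma> permutes UNIV} \<union>
    {x_op (first_positions l) \<sigma> | l \<sigma>. l \<le> CARD('r) \<and> \<sigma> permutes first_positions l})"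

definition D_alg_V :: "(('n :: finite, 'r :: {finite, linorder}) tensor \<Rightarrow> ('n, 'r) tensor) set"
  where "D_alg_V = {\<phi> \<in> D_alg. \<forall>v. Phi (e_pow v) \<circ> \<phi> = \<phi> \<circ> Phi (e_pow v)}"

definition End_commuting :: "(complex ^ 'n option \<Rightarrow> complex ^ 'n option) set
    \<Rightarrow> (('n :: finite, 'r :: finite) tensor \<Rightarrow> ('n, 'r) tensor) set"
  where "End_commuting H = {\<phi>. clinear \<phi> \<and> (\<forall>h\<in>H. \<phi> \<circ> Phi h = Phi h \<circ> \<phi>)}"


subsection \<open>The operators on pure tensors\<close>

lemma clinear_lin_ext: "clinear (lin_ext F)"
  unfolding clinear_iff lin_ext_def
  by (simp add: vec.scale_left_distrib sum.distrib vec.scale_sum_right)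

lemma pure_expand:
  assumes "\<And>i. clinear (f i)"
  shows "pure_tensor (\<lambda>i. f i (v i)) = (\<Sum>k\<in>UNIV. pure_tensor v $ k *s pure_tensor (\<lambda>i. f i (basis_at k i)))"
proof (rule vec_eq_iff[THEN iffD2], rule allI)
  fix m
  have "f i (v i) = (\<Sum>j\<in>UNIV. v i $ j *s f i (axis j 1))" for i
  proof -
    have "v i = (\<Sum>j\<in>UNIV. v i $ j *s axis j 1)"
      by (simp add: basis_expansion)
    then have "f i (v i) = f i (\<Sum>j\<in>UNIV. v i $ j *s axis j 1)"
      by simp
    then show ?thesis
      using assms[of i] by (simp add: vec.linear_sum vec.linear_scale)
  qed
  then have "pure_tensor (\<lambda>i. f i (v i)) $ m = (\<Prod>i\<in>UNIV. \<Sum>j\<in>UNIV. v i $ j * f i (axis j 1) $ m i)"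
    by (simp add: pure_tensor_def sum_component)
  also have "\<dots> = (\<Sum>k\<in>PiE UNIV (\<lambda>_. UNIV). \<Prod>i\<in>UNIV. v i $ k i * f i (axis (k i) 1) $ m i)"
    by (subst prod_sum_PiE) auto
  also have "\<dots> = (\<Sum>k\<in>UNIV. pure_tensor v $ k *s pure_tensor (\<lambda>i. f i (basis_at k i))) $ m"
    by (simp add: pure_tensor_def sum_component prod.distrib basis_at_def)
  finally show "pure_tensor (\<lambda>i. f i (v i)) $ m =
      (\<Sum>k\<in>UNIV. pure_tensor v $ k *s pure_tensor (\<lambda>i. f i (basis_at k i))) $ m" .
qed

lemma pure_basis_at: "pure_tensor (basis_at k) = axis k 1"
proof (rule vec_eq_iff[THEN iffD2], rule allI)
  fix m
  show "pure_tensor (basis_at k) $ m = (axis k 1 :: ('b, 'a) tensor) $ m"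
  proof (cases "k = m")
    case False
    then obtain i where "k i \<noteq> m i" by auto
    then have "\<exists>i\<in>UNIV. basis_at k i $ m i = 0" 
      by (auto simp: basis_at_def axis_def intro!: exI[of _ i])
    then show ?thesis
      using False by (simp add: pure_tensor_def prod_zero axis_def)
  qed (simp add: pure_tensor_def basis_at_def)
qed

lemma lin_ext_basis: "lin_ext F (pure_tensor (basis_at k)) = F k"
proof -
  have "lin_ext F (pure_tensor (basis_at k)) = (\<Sum>m\<in>UNIV. if m = k then F m else 0)"
    unfolding lin_ext_def pure_basis_at by (rule sum.cong) (auto simp: axis_def)
  then show ?thesis by simp
qed

lemma span_pure: "vec.span (range pure_tensor) = UNIV"
proof -
  have "t \<in> vec.span (range pure_tensor)" for t :: "('b, 'a) tensor"
  proof -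
    have "t = (\<Sum>k\<in>UNIV. t $ k *s pure_tensor (basis_at k))"
      by (simp add: pure_basis_at basis_expansion)
    also have "\<dots> \<in> vec.span (range pure_tensor)"
      by (intro vec.span_sum vec.span_scale vec.span_base) auto
    finally show ?thesis .
  qed
  then show ?thesis by blast
qed

lemma Phi_pure:
  assumes "clinear g"
  shows "Phi g (pure_tensor v) = pure_tensor (\<lambda>i. g (v i))"
  using pure_expand[of "\<lambda>_. g" v] assms by (simp add: Phi_def lin_ext_def)

lemma pure_perm_expand:
  fixes v :: "'r :: finite \<Rightarrow> complex ^ 'n :: finite option"
  assumes "\<sigma> permutes UNIV"
  shows "pure_tensor (\<lambda>i. v (inv \<sigma> i)) = (\<Sum>k\<in>UNIV. pure_tensor v $ k *s pure_tensor (\<lambda>i. basis_at k (inv \<sigma> i)))"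
proof -
  have b: "bij (inv \<sigma>)"
    using permutes_bij[OF permutes_inv[OF assms]] .
  have p: "pure_tensor v $ k = pure_tensor (\<lambda>i. v (inv \<sigma> i)) $ (\<lambda>i. k (inv \<sigma> i))" for k
    unfolding pure_tensor_def using prod.reindex_bij_betw[OF b, of "\<lambda>i. v i $ k i"] by simp
  have bb: "bij (\<lambda>k :: 'r \<Rightarrow> 'n option. \<lambda>i. k (inv \<sigma> i))"
  proof (rule o_bij)
    show "(\<lambda>k i. k (\<sigma> i)) \<circ> (\<lambda>k i. k (inv \<sigma> i)) = id"
      "(\<lambda>k i. k (inv \<sigma> i)) \<circ> (\<lambda>k i. k (\<sigma> i)) = id"
      using permutes_inverses[OF assms] by (auto simp: fun_eq_iff)
  qed
  have "(\<Sum>k\<in>UNIV. pure_tensor v $ k *s pure_tensor (\<lambda>i. basis_at k (inv \<sigma> i))) =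
      (\<Sum>k\<in>UNIV. pure_tensor (\<lambda>i. v (inv \<sigma> i)) $ (\<lambda>i. k (inv \<sigma> i)) *s pure_tensor (basis_at (\<lambda>i. k (inv \<sigma> i))))"
    unfolding p by (simp add: basis_at_def[abs_def])
  also have "\<dots> = (\<Sum>k\<in>UNIV. pure_tensor (\<lambda>i. v (inv \<sigma> i)) $ k *s pure_tensor (basis_at k))"
    by (rule sum.reindex_bij_betw[OF bb,
        of "\<lambda>k. pure_tensor (\<lambda>i. v (inv \<sigma> i)) $ k *s pure_tensor (basis_at k)"])
  also have "\<dots> = pure_tensor (\<lambda>i. v (inv \<sigma> i))"
    by (simp add: pure_basis_at basis_expansion)
  finally show ?thesis by simp
qed

lemma Psi_pure:
  assumes "\<sigma> permutes UNIV"
  shows "Psi \<sigma> (pure_tensor v) = pure_tensor (\<lambda>i. v (inv \<sigma> i))"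
  using pure_perm_expand[OF assms, of v] by (simp add: Psi_def lin_ext_def)

lemma pure_homog_coord:
  assumes "\<forall>i\<in>I. v i \<in> range emb" "\<forall>i\<in>-I. v i \<in> range (\<lambda>a. a *s eta)"
    and "{i. k i \<noteq> None} \<noteq> I"
  shows "pure_tensor v $ k = 0"
proof -
  obtain i where i: "(i \<in> I \<and> k i = None) \<or> (i \<notin> I \<and> k i \<noteq> None)"
  proof (rule ccontr)
    assume "\<not> thesis"
    with that have "(k i \<noteq> None) = (i \<in> I)" for i by metis
    then have "{i. k i \<noteq> None} = I" by simp
    with assms(3) show False by contradiction
  qed
  have "v i $ k i = 0"
  proof (cases "i \<in> I")
    case True
    with i assms(1) obtain u where "v i = emb u" "k i = None" by auto
    then show ?thesis by (simp add: emb_def)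
  next
    case False
    with i assms(2) obtain a where "v i = a *s eta" "k i \<noteq> None" by fastforce
    then show ?thesis by (auto simp: eta_def axis_def)
  qed
  then show ?thesis
    unfolding pure_tensor_def by (auto intro!: prod_zero)
qed

lemma x_op_pure:
  assumes "\<tau> permutes I" "\<forall>i\<in>I. v i \<in> range emb" "\<forall>i\<in>-I. v i \<in> range (\<lambda>a. a *s eta)"
  shows "x_op I \<tau> (pure_tensor v) = pure_tensor (\<lambda>i. v (inv \<tau> i))"
proof -
  have "\<tau> permutes UNIV"
    using assms(1) permutes_subset by blast
  from pure_perm_expand[OF this, of v] show ?thesis
    unfolding x_op_def lin_ext_def
    using pure_homog_coord[OF assms(2,3)] by (auto intro!: sum.cong)
qed

lemma x_op_homog_other:
  fixes t :: "('n :: finite, 'r :: finite) tensor"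
  assumes "J \<noteq> I" "t \<in> homog J"
  shows "x_op I \<tau> t = 0"
proof -
  from assms(2)[unfolded homog_def] show ?thesis
  proof (induction rule: vec.span_induct_alt)
    case base
    then show ?case by (simp add: x_op_def lin_ext_def)
  next
    case (step c x y)
    then obtain v where v: "x = pure_tensor v" "\<forall>i\<in>J. v i \<in> range emb"
      "\<forall>i\<in>-J. v i \<in> range (\<lambda>a. a *s eta)"
      by blast
    have "x_op I \<tau> x = 0"
      unfolding x_op_def lin_ext_def v(1)
      using pure_homog_coord[OF v(2,3)] assms(1) by (intro sum.neutral) auto
    moreover have "x_op I \<tau> (c *s x + y) = c *s x_op I \<tau> x + x_op I \<tau> y"
      unfolding x_op_def by (simp add: clinear_lin_ext[unfolded clinear_iff])
    ultimately show ?case using step by simp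
  qed
qed

lemma card_first_positions:
  assumes "l \<le> CARD('r :: {finite, linorder})"
  shows "card (first_positions l :: 'r set) = l"
proof -
  let ?p = "\<lambda>i :: 'r. card {..i}"
  have inj: "inj ?p"
  proof (rule linorder_injI)
    fix x y :: 'r
    assume "x < y"
    then have "{..x} \<subset> {..y}" by auto
    then show "?p x \<noteq> ?p y" by (metis finite nat_neq_iff psubset_card_mono)
  qed
  have "range ?p \<subseteq> {1..CARD('r)}"
    by (auto simp: Suc_le_eq card_gt_0_iff intro!: card_mono)
  moreover have "card (range ?p) = card {1..CARD('r)}"
    using inj by (simp add: card_image)
  ultimately have r: "range ?p = {1..CARD('r)}"
    by (intro card_subset_eq) auto
  have "?p ` first_positions l = {1..l}"
    using r assms unfolding first_positions_def by (auto simp: image_iff set_eq_iff) (metis atLeastAtMost_iff order_trans rangeE)+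
  then show ?thesis
    by (metis card_atLeastAtMost card_image diff_Suc_1 inj inj_on_subset subset_UNIV One_nat_def)
qed

end

theory Submission
  imports Defs
begin

text \<open>
  Elements of \<open>D(n,r)\<close> commute with \<open>GL(V)\<close> and \<open>G\<^sub>m\<close>, so in both cases it suffices to treat an endomorphism
  \<open>\<phi>\<close> commuting with \<open>GL(V)\<close>, \<open>G\<^sub>m\<close> and all \<open>e\<^sup>v\<close>. As \<open>n \<ge> r\<close>, there is a basis tensor \<open>e\<close> of the tensor power of
  \<open>V\<close> with distinct factors; comparing weights, \<open>\<phi> e\<close> is a combination of the \<open>\<Psi>(\<sigma>) e\<close>, and
  subtracting the corresponding combination of the \<open>\<Psi>(\<sigma>)\<close> we may assume \<open>\<phi> e = 0\<close>. Permutation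
  matrices and transvections then force \<open>\<phi>\<close> to vanish on the tensor power of \<open>V\<close>, and the \<open>e\<^sup>v\<close> propagate this
  to all tensors.
\<close>

section \<open>Linear maps determined by their values on basis tensors\<close>

lemma clinear_add: "clinear f \<Longrightarrow> f (x + y) = f x + f y"
  and clinear_scale: "clinear f \<Longrightarrow> f (c *s x) = c *s f x"
  by (simp_all add: clinear_iff)

lemma clinear_zero: "clinear f \<Longrightarrow> f 0 = 0"
  using clinear_scale[of f 0 0] by simp

lemma clinear_sum: "clinear f \<Longrightarrow> f (sum g A) = (\<Sum>a\<in>A. f (g a))"
  by (induction A rule: infinite_finite_induct) (simp_all add: clinear_zero clinear_add)

lemma clinear_comp: "clinear f \<Longrightarrow> clinear g \<Longrightarrow> clinear (f \<circ> g)"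
  by (simp add: clinear_iff)

lemma clinear_expand:
  assumes "clinear f"
  shows "f t = (\<Sum>k\<in>UNIV. t $ k *s f (axis k 1))"
proof -
  have "f t = f (\<Sum>k\<in>UNIV. t $ k *s axis k 1)"
    by (simp add: basis_expansion)
  also have "\<dots> = (\<Sum>k\<in>UNIV. t $ k *s f (axis k 1))"
    unfolding clinear_sum[OF assms] clinear_scale[OF assms] ..
  finally show ?thesis .
qed

lemma clinear_eqI:
  assumes "clinear f" "clinear g" "\<And>k. f (axis k 1) = g (axis k 1)"
  shows "f = g"
  unfolding fun_eq_iff
  by (subst clinear_expand[OF assms(1)], subst clinear_expand[OF assms(2)]) (simp add: assms(3))

section \<open>The operators on basis tensors and their commutation relations\<close>

lemma clinear_Phi: "clinear (Phi g)"
  by (simp add: Phi_def clinear_lin_ext)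

lemma clinear_Psi: "clinear (Psi \<sigma>)"
  by (simp add: Psi_def clinear_lin_ext)

lemma clinear_x_op: "clinear (x_op I \<tau>)"
  by (simp add: x_op_def clinear_lin_ext)

lemma Phi_nth: "Phi g t $ m = (\<Sum>k\<in>UNIV. t $ k * (\<Prod>i\<in>UNIV. g (axis (k i) 1) $ m i))"
  by (simp add: Phi_def lin_ext_def pure_tensor_def basis_at_def)

lemma Phi_axis: "Phi g (axis k 1) = pure_tensor (\<lambda>i. g (axis (k i) 1))"
  unfolding pure_basis_at[symmetric] Phi_def lin_ext_basis by (simp add: basis_at_def)

lemma pure_tensor_axis: "pure_tensor (\<lambda>i. axis (k i) 1) = axis k 1"
  using pure_basis_at[of k] by (simp add: basis_at_def[abs_def])

lemma Psi_axis: "Psi \<sigma> (axis k 1) = axis (k \<circ> inv \<sigma>) 1"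
  unfolding pure_basis_at[symmetric] Psi_def lin_ext_basis
  by (simp add: basis_at_def[abs_def])

lemma x_op_axis:
  fixes k :: "'r :: finite \<Rightarrow> 'n :: finite option"
  shows "x_op I \<tau> (axis k 1) = (if {i. k i \<noteq> None} = I then axis (k \<circ> inv \<tau>) 1 else 0)"
  unfolding pure_basis_at[symmetric] x_op_def lin_ext_basis
  by (simp add: basis_at_def[abs_def])

lemma Psi_Phi_commute:
  assumes "\<sigma> permutes UNIV" "clinear g"
  shows "Psi \<sigma> \<circ> Phi g = Phi g \<circ> Psi \<sigma>"
proof (rule clinear_eqI)
  show "clinear (Psi \<sigma> \<circ> Phi g)" "clinear (Phi g \<circ> Psi \<sigma>)"
    by (intro clinear_comp clinear_Psi clinear_Phi)+
qed (simp add: Phi_axis Psi_axis Psi_pure[OF assms(1)])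

lemma emb_axis: "emb (axis j 1) = axis (Some j) 1"
  by (simp add: vec_eq_iff emb_def axis_def split: option.split)

text \<open>Since \<open>g\<close> preserves both V and the line of \<open>eta\<close>,
  \<open>Phi g\<close> maps each \<open>homog J\<close> into itself. So both composites vanish on
  basis tensors outside \<open>homog I\<close>, and inside it \<open>x_op I \<tau>\<close> only
  permutes factors. The hypotheses hold for GL(V) and for the scalings of \<open>eta\<close>, but
  not for \<open>e_pow v\<close> with \<open>v \<noteq> 0\<close>.\<close>

lemma x_op_Phi_commute:
  fixes g :: "complex ^ 'n option \<Rightarrow> complex ^ ('n :: finite) option" and I :: "'r :: finite set"
  assumes "\<tau> permutes I" "\<And>u. g (emb u) \<in> range emb" "g eta \<in> range (\<lambda>a. a *s eta)"
  shows "x_op I \<tau> \<circ> Phi g = (Phi g \<circ> x_op I \<tau> :: ('n, 'r) tensor \<Rightarrow> _)"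
proof (rule clinear_eqI)
  show "clinear (x_op I \<tau> \<circ> Phi g :: ('n, 'r) tensor \<Rightarrow> _)"
    "clinear (Phi g \<circ> x_op I \<tau> :: ('n, 'r) tensor \<Rightarrow> _)"
    by (intro clinear_comp clinear_x_op clinear_Phi)+
next
  fix k :: "'r \<Rightarrow> 'n option"
  let ?J = "{i. k i \<noteq> None}" and ?v = "\<lambda>i. g (axis (k i) 1)"
  have v: "\<forall>i\<in>?J. ?v i \<in> range emb" "\<forall>i\<in>-?J. ?v i \<in> range (\<lambda>a. a *s eta)"
    using assms(2,3) by (auto simp: eta_def emb_axis[symmetric])
  show "(x_op I \<tau> \<circ> Phi g) (axis k 1) = (Phi g \<circ> x_op I \<tau>) (axis k 1)"
  proof (cases "?J = I")
    case True
    then show ?thesis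
      using x_op_pure[OF assms(1), of ?v] v by (simp add: Phi_axis x_op_axis)
  next
    case False
    have "pure_tensor ?v \<in> homog ?J"
      unfolding homog_def using v by (intro vec.span_base) blast
    with False show ?thesis
      by (simp add: Phi_axis x_op_axis x_op_homog_other[OF False] clinear_zero[OF clinear_Phi])
  qed
qed

section \<open>Subalgebras and the hulls they define\<close>

text \<open>By \<open>hull_minimal\<close>, this reduces commutation of a generated algebra to its
  generators. For \<open>H = {}\<close> it gives the algebra of all linear endomorphisms.\<close>

lemma subalg_End_commuting:
  "subalg_End {\<phi>. clinear \<phi> \<and> (\<forall>h\<in>H. \<phi> \<circ> Phi h = Phi h \<circ> \<phi>)}"
  unfolding subalg_End_def
  by (auto simp: clinear_comp fun_eq_iff clinear_add[OF clinear_Phi] clinear_scale[OF clinear_Phi])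
     (simp_all add: clinear_iff algebra_simps)

lemma subalg_End_Inter:
  assumes "\<And>A. A \<in> \<A> \<Longrightarrow> subalg_End A" "\<A> \<noteq> {}"
  shows "subalg_End (\<Inter>\<A>)"
  unfolding subalg_End_def
proof (intro conjI ballI allI InterI)
  show "\<Inter>\<A> \<subseteq> {\<phi>. clinear \<phi>}"
    using assms by (fastforce simp: subalg_End_def)
qed (use assms(1) in \<open>simp_all add: subalg_End_def\<close>)

lemma subalg_End_hull:
  assumes "S \<subseteq> {\<phi>. clinear \<phi>}"
  shows "subalg_End (subalg_End hull S)"
  \<comment> \<open>The commutant of the empty set contains \<open>S\<close>, so the family being
    intersected is nonempty.\<close>
  unfolding hull_def using assms subalg_End_commuting[of "{}"]
  by (intro subalg_End_Inter) auto

lemma subalg_End_sum: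
  assumes "subalg_End A" "\<And>s. s \<in> S \<Longrightarrow> f s \<in> A"
  shows "(\<lambda>t. \<Sum>s\<in>S. c s *s f s t) \<in> A"
proof -
  have add: "(\<lambda>t. \<phi> t + \<psi> t) \<in> A" if "\<phi> \<in> A" "\<psi> \<in> A" for \<phi> \<psi>
    using assms(1) that by (simp add: subalg_End_def)
  have scale: "(\<lambda>t. a *s \<phi> t) \<in> A" if "\<phi> \<in> A" for a \<phi>
    using assms(1) that by (simp add: subalg_End_def)
  have "id \<in> A"
    using assms(1) by (simp add: subalg_End_def)
  \<comment> \<open>The zero map serves the empty sum and also an infinite \<open>S\<close>, where
    \<open>sum\<close> is 0 by convention.\<close>
  from scale[OF this, of 0] have zero: "(\<lambda>t. 0) \<in> A"
    by simp
  show ?thesis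
    using assms(2)
    by (induction S rule: infinite_finite_induct) (simp_all add: zero add scale)
qed

section \<open>Auxiliary facts on enhanced maps, tensors and injections\<close>

lemma enh_nth: "enh g v w $ b =
    (case b of None \<Rightarrow> w $ None | Some l \<Rightarrow> g (V_part w) $ l + w $ None * v $ l)"
  by (simp add: enh_def emb_def eta_def eta_part_def axis_def split: option.split)

lemma enh_axis_Some: "enh g 0 (axis (Some j) 1) = emb (g (axis j 1))"
proof -
  have "V_part (axis (Some j) 1) = axis j 1"
    by (simp add: V_part_def vec_eq_iff axis_def)
  then show ?thesis
    by (simp add: enh_def eta_part_def axis_def)
qed

text \<open>Additivity in the single slot \<open>i\<close>; it expands the image of a basis tensor
  under a transvection.\<close>

lemma pure_tensor_add:
  assumes "w i = u i + v i" "\<And>j. j \<noteq> i \<Longrightarrow> u j = w j" "\<And>j. j \<noteq> i \<Longrightarrow> v j = w j"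
  shows "pure_tensor w = pure_tensor u + pure_tensor v"
proof -
  have "(\<Prod>j\<in>UNIV. x j $ k j) = x i $ k i * (\<Prod>j\<in>UNIV - {i}. w j $ k j)"
    if "\<And>j. j \<noteq> i \<Longrightarrow> x j = w j" for x k
    using that by (subst prod.remove[of _ i]) auto
  from this[of w] this[of u] this[of v] assms show ?thesis
    by (simp add: vec_eq_iff pure_tensor_def distrib_right)
qed

text \<open>The two ranges have equinumerous complements, so a bijection between these can be glued
  to \<open>g \<circ> inv f\<close>. The result yields a permutation matrix carrying one basis
  tensor with distinct factors to another.\<close>

lemma ex_bij_extending_inj:
  fixes f g :: "'r \<Rightarrow> 'n :: finite"
  assumes "inj f" "inj g"
  obtains p where "bij p" "p \<circ> f = g"
proof -
  have "card (- range f) = card (- range g)"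
    using card_image[OF assms(1)] card_image[OF assms(2)] by (simp add: card_Diff_subset Compl_eq_Diff_UNIV)
  then obtain h where h: "bij_betw h (- range f) (- range g)"
    using finite_same_card_bij[of "- range f" "- range g"] by auto
  define p where "p x = (if x \<in> range f then g (inv f x) else h x)" for x
  have "bij_betw p (range f) (range g)"
    using assms by (auto simp: bij_betw_def inj_on_def p_def image_image)
  moreover have "bij_betw p (- range f) (- range g)"
    using h by (rule iffD1[OF bij_betw_cong, rotated]) (auto simp: p_def)
  ultimately have "bij_betw p (range f \<union> - range f) (range g \<union> - range g)"
    by (rule bij_betw_combine) auto
  moreover have "p \<circ> f = g"
    using assms(1) by (auto simp: p_def fun_eq_iff)
  ultimately show thesis using that by simp
qed

section \<open>Endomorphisms equivariant under the parabolic subgroup\<close>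

text \<open>The common ground of both equalities: equivariance is asked only for the three kinds of
  generators, so it can be verified for elements of \<open>D_alg_V\<close> as well as for
  \<open>End_commuting enhanced_Gm\<close>.\<close>

locale parabolic_equivariant =
  fixes \<phi> :: "('n :: finite, 'r :: finite) tensor \<Rightarrow> ('n, 'r) tensor"
  assumes linear: "clinear \<phi>"
    and GL_commute: "g \<in> carrier GL \<Longrightarrow> \<phi> (Phi (enh g 0) t) = Phi (enh g 0) (\<phi> t)"
    and e_pow_commute: "\<phi> (Phi (e_pow v) t) = Phi (e_pow v) (\<phi> t)"
    and scale_eta_commute: "c \<noteq> 0 \<Longrightarrow> \<phi> (Phi (scale_eta c) t) = Phi (scale_eta c) (\<phi> t)"
begin

text \<open>The diagonal map \<open>s\<close> doubling the coordinate \<open>b\<close> lies in the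
  torus: it is \<open>scale_eta 2\<close> for \<open>b = None\<close> and comes from GL(V)
  otherwise. It scales a basis tensor by 2 to the multiplicity of \<open>b\<close>, and \<phi>
  preserves its eigenspaces.\<close>

lemma weight:
  assumes "\<phi> (axis k 1) $ m \<noteq> 0"
  shows "card {i. m i = b} = card {i. k i = b}"
proof -
  define s :: "complex ^ 'n option \<Rightarrow> complex ^ 'n option"
    where "s w = (\<chi> a. if a = b then 2 * w $ a else w $ a)" for w
  have commute: "\<phi> (Phi s t) = Phi s (\<phi> t)" for t
  proof (cases b)
    case None
    then have "s = scale_eta 2"
      by (auto simp: s_def scale_eta_def vec_eq_iff fun_eq_iff emb_def eta_def axis_def
          V_part_def eta_part_def split: option.split)
    then show ?thesis by (simp add: scale_eta_commute)
  next
    case (Some j)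
    define g :: "complex ^ 'n \<Rightarrow> complex ^ 'n"
      where "g u = (\<chi> a. if a = j then 2 * u $ a else u $ a)" for u
    define g' :: "complex ^ 'n \<Rightarrow> complex ^ 'n"
      where "g' u = (\<chi> a. if a = j then u $ a / 2 else u $ a)" for u
    have "g \<circ> g' = id" "g' \<circ> g = id"
      by (auto simp: g_def g'_def fun_eq_iff vec_eq_iff)
    then have "bij g" by (metis o_bij)
    then have "g \<in> carrier GL"
      by (auto simp: mem_GL_iff clinear_iff g_def vec_eq_iff distrib_left)
    moreover have "s = enh g 0"
      using Some by (auto simp: s_def fun_eq_iff vec_eq_iff enh_nth g_def V_part_def split: option.split)
    ultimately show ?thesis by (simp add: GL_commute)
  qed
  have s_axis: "s (axis a 1) = (if a = b then 2 else 1) *s axis a 1" for a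
    by (auto simp: s_def vec_eq_iff axis_def)
  have s_pure: "Phi s (axis q 1) = 2 ^ card {i. q i = b} *s axis q 1" for q :: "'r \<Rightarrow> 'n option"
  proof -
    have "Phi s (axis q 1) $ p = 2 ^ card {i. q i = b} * axis q 1 $ p" for p
    proof -
      have "Phi s (axis q 1) $ p =
          (\<Prod>i\<in>UNIV. (if q i = b then 2 else 1)) * pure_tensor (\<lambda>i. axis (q i) 1) $ p"
        by (simp add: Phi_axis s_axis pure_tensor_def prod.distrib)
      also have "(\<Prod>i\<in>UNIV. (if q i = b then 2 else 1 :: complex)) = 2 ^ card {i. q i = b}"
        by (simp add: prod.If_cases)
      finally show ?thesis by (simp add: pure_tensor_axis)
    qed
    then show ?thesis by (simp add: vec_eq_iff)
  qed
  have "Phi s t $ m = 2 ^ card {i. m i = b} * t $ m" for t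
  proof -
    have s_nth: "Phi s (axis q 1) $ m = (if q = m then 2 ^ card {i. q i = b} else 0)" for q
      unfolding s_pure by (simp add: axis_def)
    have "Phi s t $ m = (\<Sum>q\<in>UNIV. t $ q * Phi s (axis q 1) $ m)"
      by (simp only: clinear_expand[OF clinear_Phi, of s t] sum_component vector_smult_component)
    also have "\<dots> = (\<Sum>q\<in>UNIV. if q = m then t $ q * 2 ^ card {i. q i = b} else 0)"
      unfolding s_nth by (rule sum.cong) simp_all
    finally show ?thesis by simp
  qed
  from this[of "\<phi> (axis k 1)"] have "2 ^ card {i. m i = b} * \<phi> (axis k 1) $ m =
      \<phi> (Phi s (axis k 1)) $ m"
    by (simp add: commute)
  also have "\<dots> = 2 ^ card {i. k i = b} * \<phi> (axis k 1) $ m"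
    by (simp add: s_pure clinear_scale[OF linear])
  finally have "(2 :: complex) ^ card {i. m i = b} = 2 ^ card {i. k i = b}"
    using assms by simp
  \<comment> \<open>Taking norms moves the equation to the reals, where powers of 2 determine their
    exponents.\<close>
  from arg_cong[OF this, of norm] show ?thesis
    by (simp add: norm_power)
qed

lemma weight_range:
  assumes "\<phi> (axis k 1) $ m \<noteq> 0"
  shows "range m = range k"
proof -
  have iff: "b \<in> range q \<longleftrightarrow> card {i. q i = b} \<noteq> 0" for b and q :: "'r \<Rightarrow> 'n option"
    by auto
  show ?thesis
    by (rule Set.set_eqI) (simp only: iff weight[OF assms])
qed

text \<open>Induction on the number of values lost by repetition. For injective
  \<open>\<kappa>\<close>, a permutation matrix carries the tensor of \<open>k0\<close> to that of
  \<open>\<kappa>\<close>. Otherwise one repeated value is replaced by a fresh one, and a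
  transvection recovers \<open>\<kappa>\<close> from the result.\<close>

lemma vanish_on_V:
  fixes k0 \<kappa> :: "'r \<Rightarrow> 'n"
  assumes k0: "inj k0" "\<phi> (axis (Some \<circ> k0) 1) = 0"
  shows "\<phi> (axis (Some \<circ> \<kappa>) 1) = 0"
proof (induction "CARD('r) - card (range \<kappa>)" arbitrary: \<kappa> rule: less_induct)
  case less
  show ?case
  proof (cases "inj \<kappa>")
    case True
    obtain p where p: "bij p" "p \<circ> k0 = \<kappa>"
      using ex_bij_extending_inj[OF k0(1) True] .
    define g :: "complex ^ 'n \<Rightarrow> complex ^ 'n" where "g u = (\<chi> a. u $ inv p a)" for u
    define g' :: "complex ^ 'n \<Rightarrow> complex ^ 'n" where "g' u = (\<chi> a. u $ p a)" for u
    have "g \<circ> g' = id" "g' \<circ> g = id"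
      using p(1) by (auto simp: g_def g'_def fun_eq_iff vec_eq_iff bij_is_surj surj_f_inv_f bij_is_inj)
    then have "bij g" by (metis o_bij)
    then have g: "g \<in> carrier GL"
      by (simp add: mem_GL_iff clinear_iff g_def vec_eq_iff)
    have "inv p a = j \<longleftrightarrow> a = p j" for a j
      using p(1) by (metis bij_inv_eq_iff)
    then have "g (axis j 1) = axis (p j) 1" for j
      by (simp add: g_def vec_eq_iff axis_def)
    then have "Phi (enh g 0) (axis (Some \<circ> k0) 1) = axis (Some \<circ> \<kappa>) 1"
      unfolding Phi_axis unfolding pure_tensor_axis[symmetric] p(2)[symmetric]
      by (simp add: enh_axis_Some emb_axis)
    then show ?thesis
      using GL_commute[OF g, of "axis (Some \<circ> k0) 1"] k0(2) by (simp add: clinear_zero[OF clinear_Phi])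
  next
    case False
    then obtain i i' where i: "i \<noteq> i'" "\<kappa> i = \<kappa> i'" by (auto simp: inj_def)
    have "card (range \<kappa>) \<noteq> CARD('r)"
      using False eq_card_imp_inj_on[of UNIV \<kappa>] by auto
    then have "card (range \<kappa>) < CARD('r)"
      using card_image_le[of UNIV \<kappa>] by simp
    \<comment> \<open>The injection \<open>k0\<close> supplies the bound that leaves room for a
      fresh value \<open>b\<close>.\<close>
    also have "CARD('r) \<le> CARD('n)"
      using card_mono[of UNIV "range k0"] card_image[OF k0(1)] by simp
    finally have "range \<kappa> \<noteq> UNIV" by auto
    then obtain b where b: "b \<notin> range \<kappa>" by blast
    define a where "a = \<kappa> i"
    have ab: "a \<noteq> b" using b by (auto simp: a_def)
    define \<kappa>' where "\<kappa>' = \<kappa>(i := b)"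
    have "range \<kappa>' = insert b (range \<kappa>)"
    proof -
      have "\<kappa> j \<in> range \<kappa>'" for j
        using i by (cases "j = i") (auto simp: \<kappa>'_def image_iff intro: exI[of _ i'] exI[of _ j])
      moreover have "b \<in> range \<kappa>'" by (auto simp: \<kappa>'_def image_iff intro: exI[of _ i])
      ultimately show ?thesis by (auto simp: \<kappa>'_def)
    qed
    then have IH: "\<phi> (axis (Some \<circ> \<kappa>') 1) = 0"
      using b \<open>card (range \<kappa>) < CARD('r)\<close> by (intro less) simp
    \<comment> \<open>The transvection adding basis vector \<open>a\<close> to basis vector
      \<open>b\<close>. As \<open>b\<close> occurs in \<open>\<kappa>'\<close> only at
      \<open>i\<close>, the tensor of \<open>\<kappa>'\<close> goes to itself plus that of
      \<open>\<kappa>\<close>.\<close>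
    define g :: "complex ^ 'n \<Rightarrow> complex ^ 'n" where "g u = u + u $ b *s axis a 1" for u
    define g' :: "complex ^ 'n \<Rightarrow> complex ^ 'n" where "g' u = u - u $ b *s axis a 1" for u
    have "g \<circ> g' = id" "g' \<circ> g = id"
      using ab by (auto simp: g_def g'_def fun_eq_iff vec_eq_iff axis_def)
    then have "bij g" by (metis o_bij)
    then have g: "g \<in> carrier GL"
      by (auto simp: mem_GL_iff clinear_iff g_def vec_eq_iff algebra_simps)
    have gb: "enh g 0 (axis (Some b) 1) = axis (Some b) 1 + axis (Some a) 1"
      by (simp add: enh_axis_Some g_def emb_linear emb_axis)
    have go: "enh g 0 (axis (Some j) 1) = axis (Some j) 1" if "j \<noteq> b" for j
      using that by (simp add: enh_axis_Some g_def emb_axis) (simp add: axis_def emb_axis[unfolded axis_def])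
    have "Phi (enh g 0) (axis (Some \<circ> \<kappa>') 1) = axis (Some \<circ> \<kappa>') 1 + axis (Some \<circ> \<kappa>) 1"
      unfolding Phi_axis unfolding pure_tensor_axis[symmetric]
    proof (rule pure_tensor_add)
      show "enh g 0 (axis ((Some \<circ> \<kappa>') i) 1) = axis ((Some \<circ> \<kappa>') i) 1 + axis ((Some \<circ> \<kappa>) i) 1"
        by (simp add: \<kappa>'_def gb a_def)
    next
      fix j assume "j \<noteq> i"
      moreover have "\<kappa> j \<noteq> b" using b by auto
      ultimately show "axis ((Some \<circ> \<kappa>') j) 1 = enh g 0 (axis ((Some \<circ> \<kappa>') j) 1)"
        "axis ((Some \<circ> \<kappa>) j) 1 = enh g 0 (axis ((Some \<circ> \<kappa>') j) 1)"
        by (simp_all add: \<kappa>'_def go)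
    qed
    then show ?thesis
      using GL_commute[OF g, of "axis (Some \<circ> \<kappa>') 1"] IH
      by (simp add: clinear_add[OF linear] clinear_zero[OF clinear_Phi])
  qed
qed

text \<open>
  Since \<open>n \<ge> r\<close>, an index \<open>k\<close> involving \<open>\<eta>\<close> misses some basis vector \<open>f\<^sub>j\<close> of \<open>V\<close>, and by weights so
  does the image of the basis tensor at \<open>k\<close>. Hence \<open>e\<^sup>v\<close> for \<open>v = f\<^sub>j\<close>, by turning every \<open>\<eta>\<close> into \<open>f\<^sub>j\<close>,
  moves the coordinates of this image without overlap into the tensor power of \<open>V\<close>, where \<open>\<phi>\<close>
  vanishes.
\<close>

lemma vanish:
  assumes V: "\<And>\<kappa> :: 'r \<Rightarrow> 'n. \<phi> (axis (Some \<circ> \<kappa>) 1) = 0" and card: "CARD('r) \<le> CARD('n)"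
  shows "\<phi> t = 0"
proof -
  have no_None: "\<phi> (axis q 1) = 0" if "None \<notin> range q" for q
  proof -
    have "q = Some \<circ> (the \<circ> q)"
    proof
      fix i
      have "q i \<noteq> None" using that by (metis rangeI)
      then show "q i = (Some \<circ> (the \<circ> q)) i" by simp
    qed
    then show ?thesis using V by metis
  qed
  have "\<phi> (axis k 1) $ m = 0" for k m
  proof (rule ccontr)
    assume nz: "\<phi> (axis k 1) $ m \<noteq> 0"
    have None: "None \<in> range k"
      by (rule ccontr) (use nz no_None[of k] in simp)
    have "card (Some -` range k) < CARD('n)"
    proof -
      have "card (Some -` range k) = card (Some ` (Some -` range k))"
        by (rule card_image[symmetric]) simp
      also have "\<dots> \<le> card (range k - {None})"
        by (intro card_mono) auto
      also have "\<dots> < card (range k)"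
        using None by (intro card_Diff1_less) auto
      also have "\<dots> \<le> CARD('r)" by (simp add: card_image_le)
      finally show ?thesis using card by simp
    qed
    then have "Some -` range k \<noteq> UNIV" by auto
    then obtain j where j: "Some j \<notin> range k" by blast
    define m' where "m' i = (if m i = None then Some j else m i)" for i
    have e: "e_pow (axis j 1) (axis a 1) $ b = (if a = b \<or> a = None \<and> b = Some j then 1 else 0)"
      for a b
      by (cases b) (auto simp: e_pow_def enh_nth V_part_def axis_def)
    let ?c = "\<lambda>q. \<Prod>i\<in>UNIV. e_pow (axis j 1) (axis (q i) 1) $ m' i"
    have mj: "m i \<noteq> Some j" for i
      using weight_range[OF nz] j by (metis rangeI)
    have "Phi (e_pow (axis j 1)) (\<phi> (axis k 1)) $ m' = (\<Sum>q\<in>UNIV. \<phi> (axis k 1) $ q * ?c q)"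
      by (simp add: Phi_nth)
    also have "\<dots> = (\<Sum>q\<in>UNIV. if q = m then \<phi> (axis k 1) $ m else 0)"
    proof (rule sum.cong[OF refl])
      fix q
      show "\<phi> (axis k 1) $ q * ?c q = (if q = m then \<phi> (axis k 1) $ m else 0)"
      proof (cases "q = m")
        case True
        have "e_pow (axis j 1) (axis (m i) 1) $ m' i = 1" for i
          by (simp add: e m'_def)
        with True show ?thesis by simp
      next
        case False
        \<comment> \<open>Neither \<open>q\<close> nor \<open>m\<close> takes the value
          \<open>Some j\<close>. So at a slot where they differ, \<open>e_pow (axis j 1)\<close>
          cannot send the factor of \<open>q\<close> to a vector with nonzero coordinate
          \<open>m' i\<close>.\<close>
        have "?c q = 0" if "\<phi> (axis k 1) $ q \<noteq> 0"
        proof -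
          have qj: "q i \<noteq> Some j" for i
            using weight_range[OF that] j by (metis rangeI)
          obtain i where "q i \<noteq> m i" using False by auto
          then have "e_pow (axis j 1) (axis (q i) 1) $ m' i = 0"
            using mj[of i] qj[of i] by (auto simp: e m'_def)
          then show ?thesis by (auto intro: prod_zero)
        qed
        with False show ?thesis by auto
      qed
    qed
    also have "\<dots> = \<phi> (axis k 1) $ m" by simp
    finally have "\<phi> (axis k 1) $ m = \<phi> (Phi (e_pow (axis j 1)) (axis k 1)) $ m'"
      by (simp add: e_pow_commute)
    also have "\<dots> = 0"
    proof -
      have "None \<notin> range m'" by (auto simp: m'_def split: if_splits)
      \<comment> \<open>If \<open>q\<close> avoids \<open>None\<close>, the whole image vanishes;
        otherwise \<open>m'\<close> and \<open>q\<close> have different ranges, contrary to the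
        weights.\<close>
      then have "\<phi> (axis q 1) $ m' = 0" for q
        using no_None[of q] weight_range[of q m'] by (cases "None \<in> range q") auto
      then show ?thesis
        by (subst clinear_expand[OF linear]) simp
    qed
    finally show False using nz by contradiction
  qed
  then have "\<phi> (axis k 1) = 0" for k
    by (simp add: vec_eq_iff)
  then show ?thesis by (subst clinear_expand[OF linear]) simp
qed

end

section \<open>Equivariant endomorphisms as combinations of place permutations\<close>

lemma parabolic_equivariant_diff:
  fixes \<phi> \<psi> :: "('n :: finite, 'r :: finite) tensor \<Rightarrow> ('n, 'r) tensor"
  assumes "parabolic_equivariant \<phi>" "parabolic_equivariant \<psi>"
  shows "parabolic_equivariant (\<lambda>t. \<phi> t - \<psi> t)"
proof -
  interpret p: parabolic_equivariant \<phi> by fact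
  interpret q: parabolic_equivariant \<psi> by fact
  have diff: "Phi g (x - y) = Phi g x - Phi g y" for g and x y :: "('n, 'r) tensor"
    using clinear_add[OF clinear_Phi, of g "x - y" y] by (simp add: algebra_simps)
  show ?thesis
    by (rule parabolic_equivariant.intro)
      (simp_all add: diff p.GL_commute q.GL_commute p.e_pow_commute q.e_pow_commute
        p.scale_eta_commute q.scale_eta_commute clinear_iff clinear_add[OF p.linear] clinear_add[OF q.linear]
        clinear_scale[OF p.linear] clinear_scale[OF q.linear] vec.scale_right_diff_distrib)
qed

lemma commuting_imp_parabolic_equivariant:
  fixes \<phi> :: "('n :: finite, 'r :: finite) tensor \<Rightarrow> ('n, 'r) tensor"
  assumes "clinear \<phi>" "\<And>h. h \<in> enhanced_Gm \<Longrightarrow> \<phi> \<circ> Phi h = Phi h \<circ> \<phi>"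
  shows "parabolic_equivariant \<phi>"
proof -
  have gen: "h \<in> enhanced_group \<union> Gm \<Longrightarrow> h \<in> enhanced_Gm" for h
    unfolding enhanced_Gm_def by (rule generate.incl)
  have *: "\<phi> (Phi h t) = Phi h (\<phi> t)" if "h \<in> enhanced_group \<union> Gm" for h t
    using fun_cong[OF assms(2)[OF gen[OF that]]] by simp
  have enh: "enh g v \<in> enhanced_group" if "g \<in> carrier GL" for g :: "complex ^ 'n \<Rightarrow> complex ^ 'n" and v
    using that by (auto simp: enhanced_group_def)
  have id: "id \<in> carrier GL"
    by (simp add: mem_GL_iff clinear_iff)
  have Gm: "scale_eta c \<in> Gm" if "c \<noteq> 0" for c
    using that by (auto simp: Gm_def)
  show ?thesis
    by (rule parabolic_equivariant.intro)
      (simp_all add: assms(1) * enh Gm id e_pow_def)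
qed

lemma C_Psi_subset:
  assumes "H \<subseteq> {h. clinear h}"
  shows "C_Psi \<subseteq> End_commuting H"
  unfolding C_Psi_def End_commuting_def
  using assms by (intro hull_minimal subalg_End_commuting) (auto simp: clinear_Psi Psi_Phi_commute)

lemma enhanced_Gm_clinear: "enhanced_Gm \<subseteq> {h. clinear h}"
  by (auto simp: enhanced_Gm_eq_parabolic mem_GL_iff)

text \<open>The combination \<open>\<theta>\<close> is built to agree with \<phi> on one basis
  tensor with distinct factors; the equivariant difference then vanishes everywhere.\<close>

lemma parabolic_equivariant_in_C_Psi:
  fixes \<phi> :: "('n :: finite, 'r :: finite) tensor \<Rightarrow> ('n, 'r) tensor"
  assumes "parabolic_equivariant \<phi>" and card: "CARD('r) \<le> CARD('n)"
  shows "\<phi> \<in> C_Psi"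
proof -
  interpret p: parabolic_equivariant \<phi> by fact
  obtain k0 :: "'r \<Rightarrow> 'n" where k0: "inj k0"
    using card_le_inj[of "UNIV :: 'r set" "UNIV :: 'n set"] card by auto
  define P where "P = {\<sigma> :: 'r \<Rightarrow> 'r. \<sigma> permutes UNIV}"
  \<comment> \<open>By \<open>Psi_axis\<close>, this is the coordinate of the image at the basis
    tensor obtained by applying \<open>Psi \<sigma>\<close>.\<close>
  define a where "a \<sigma> = \<phi> (axis (Some \<circ> k0) 1) $ (Some \<circ> k0 \<circ> inv \<sigma>)" for \<sigma>
  define \<theta> where "\<theta> t = (\<Sum>\<sigma>\<in>P. a \<sigma> *s Psi \<sigma> t)" for t :: "('n, 'r) tensor"
  have "finite P" by (simp add: P_def)
  have gen: "{Psi \<sigma> | \<sigma>. \<sigma> permutes UNIV} \<subseteq> (C_Psi :: (('n, 'r) tensor \<Rightarrow> _) set)"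
    unfolding C_Psi_def by (rule hull_subset)
  have sub: "subalg_End (C_Psi :: (('n, 'r) tensor \<Rightarrow> _) set)"
    unfolding C_Psi_def by (rule subalg_End_hull) (auto simp: clinear_Psi)
  have \<theta>: "\<theta> \<in> C_Psi"
    unfolding \<theta>_def using gen by (intro subalg_End_sum[OF sub]) (auto simp: P_def)
  then have "\<theta> \<in> End_commuting enhanced_Gm"
    using C_Psi_subset[OF enhanced_Gm_clinear] by blast
  then have "parabolic_equivariant \<theta>"
    by (intro commuting_imp_parabolic_equivariant) (auto simp: End_commuting_def)
  with assms(1) interpret d: parabolic_equivariant "\<lambda>t. \<phi> t - \<theta> t"
    by (rule parabolic_equivariant_diff)
  have Psi_nth: "Psi \<sigma> (axis (Some \<circ> k0) 1) $ q = (if q = Some \<circ> k0 \<circ> inv \<sigma> then 1 else 0)"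
    for \<sigma> :: "'r \<Rightarrow> 'r" and q
    unfolding Psi_axis by (simp add: axis_def)
  have "\<phi> (axis (Some \<circ> k0) 1) $ m = \<theta> (axis (Some \<circ> k0) 1) $ m" for m
  proof (cases "\<exists>\<sigma>\<in>P. m = Some \<circ> k0 \<circ> inv \<sigma>")
    case True
    then obtain \<sigma> where \<sigma>: "\<sigma> permutes UNIV" "m = Some \<circ> k0 \<circ> inv \<sigma>"
      by (auto simp: P_def)
    \<comment> \<open>Injectivity of \<open>k0\<close> makes the permuted basis tensors distinct, so
      exactly one summand of \<open>\<theta>\<close> contributes at \<open>m\<close>.\<close>
    have "\<tau> = \<sigma>" if "\<tau> permutes UNIV" "m = Some \<circ> k0 \<circ> inv \<tau>" for \<tau>
    proof -
      have "inv \<sigma> = inv \<tau>"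
        using that(2) \<sigma>(2) injD[OF k0] by (auto simp: fun_eq_iff)
      then show ?thesis
        using that(1) \<sigma>(1) by (metis permutes_inv_inv)
    qed
    then have "Psi \<tau> (axis (Some \<circ> k0) 1) $ m = (if \<tau> = \<sigma> then 1 else 0)" if "\<tau> \<in> P" for \<tau>
      using that \<sigma>(2) unfolding Psi_nth P_def by auto
    then have "\<theta> (axis (Some \<circ> k0) 1) $ m = (\<Sum>\<tau>\<in>P. if \<tau> = \<sigma> then a \<tau> else 0)"
      unfolding \<theta>_def by (simp only: sum_component vector_smult_component, intro sum.cong) auto
    also have "\<dots> = a \<sigma>"
      using \<sigma>(1) \<open>finite P\<close> by (simp add: P_def)
    finally show ?thesis by (simp add: a_def \<sigma>(2))
  next
    case False
    then have "\<theta> (axis (Some \<circ> k0) 1) $ m = 0"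
      unfolding \<theta>_def by (auto simp: Psi_nth sum_component intro!: sum.neutral)
    moreover have "\<phi> (axis (Some \<circ> k0) 1) $ m = 0"
    proof (rule ccontr)
      assume nz: "\<phi> (axis (Some \<circ> k0) 1) $ m \<noteq> 0"
      have "range m = range (Some \<circ> k0)"
        using p.weight_range[OF nz] .
      then have ex: "\<forall>i. \<exists>i'. m i = Some (k0 i')"
        by (metis comp_apply image_iff rangeI)
      then obtain \<pi> where \<pi>: "\<And>i. m i = Some (k0 (\<pi> i))" by metis
      \<comment> \<open>Having as many values as slots, \<open>m\<close> is injective, hence a
        rearrangement of \<open>Some \<circ> k0\<close>, which this case excludes.\<close>
      have "card (range (Some \<circ> k0)) = CARD('r)"
        using k0 by (intro card_image inj_compose) simp_all
      then have "inj m"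
        using \<open>range m = _\<close> by (intro eq_card_imp_inj_on) simp_all
      then have "inj \<pi>" using \<pi> by (metis injI injD)
      then have \<pi>p: "\<pi> permutes UNIV"
        by (intro bij_imp_permutes) (simp_all add: bij_def finite_UNIV_inj_surj)
      then have "inv \<pi> \<in> P" by (simp add: P_def permutes_inv)
      moreover have "m = Some \<circ> k0 \<circ> inv (inv \<pi>)"
        using \<pi> \<pi>p by (simp add: fun_eq_iff permutes_inv_inv)
      ultimately show False using False by blast
    qed
    ultimately show ?thesis by simp
  qed
  then have "\<phi> (axis (Some \<circ> k0) 1) - \<theta> (axis (Some \<circ> k0) 1) = 0"
    by (simp add: vec_eq_iff)
  from d.vanish[OF d.vanish_on_V[OF k0 this] card] have "\<phi> = \<theta>"
    by (simp add: fun_eq_iff)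
  with \<theta> show ?thesis by simp
qed

section \<open>The degenerate double Hecke algebra and the two equalities\<close>

text \<open>Checked on generators: GL(V) and the scalings preserve V and the line of
  \<open>eta\<close>, as \<open>x_op_Phi_commute\<close> requires. The maps \<open>e_pow v\<close>
  are absent because the \<open>x_op\<close> generators need not commute with them.\<close>

lemma D_alg_subset:
  "(D_alg :: (('n :: finite, 'r :: {finite, linorder}) tensor \<Rightarrow> ('n, 'r) tensor) set)
    \<subseteq> End_commuting ({enh g 0 | g. g \<in> carrier GL} \<union> Gm)"
  unfolding D_alg_def End_commuting_def
proof (intro hull_minimal subalg_End_commuting Un_least subsetI)
  let ?H = "{enh g 0 | g. g \<in> carrier GL} \<union> Gm :: (complex ^ 'n option \<Rightarrow> complex ^ 'n option) set"
  fix f :: "('n, 'r) tensor \<Rightarrow> ('n, 'r) tensor"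
  {
    assume "f \<in> {Psi \<sigma> | \<sigma>. \<sigma> permutes UNIV}"
    moreover have "clinear h" if "h \<in> ?H" for h
      using that enh_in_GL scale_eta_in_GL by (auto simp: Gm_def mem_GL_iff)
    ultimately show "f \<in> {\<phi>. clinear \<phi> \<and> (\<forall>h\<in>?H. \<phi> \<circ> Phi h = Phi h \<circ> \<phi>)}"
      using Psi_Phi_commute clinear_Psi by blast
  next
    assume "f \<in> {x_op (first_positions l) \<sigma> | l \<sigma>. l \<le> CARD('r) \<and> \<sigma> permutes first_positions l}"
    then obtain l \<sigma> where f: "f = x_op (first_positions l) \<sigma>" "\<sigma> permutes first_positions l"
      by blast
    have stable: "h (emb u) \<in> range emb" "h eta \<in> range (\<lambda>a. a *s eta)" if "h \<in> ?H" for h u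
    proof -
      have "h (emb u) \<in> range emb \<and> h eta \<in> range (\<lambda>a. a *s eta)"
        using that
      proof (elim UnE)
        assume "h \<in> {enh g 0 | g. g \<in> carrier GL}"
        then obtain g where g: "h = enh g 0" "clinear g" by (auto simp: mem_GL_iff)
        show ?thesis
          using enh_apply[of g 0 u 0] enh_apply[of g 0 0 1] clinear_zero[OF g(2)]
          by (auto simp: g(1) emb_linear(2)[of 0, simplified] intro: range_eqI[of _ _ 1])
      next
        assume "h \<in> Gm"
        then obtain c where "h = scale_eta c" by (auto simp: Gm_def)
        then show ?thesis
          using scale_eta_apply[of c u 0] scale_eta_apply[of c 0 1]
          by (auto simp: emb_linear(2)[of 0, simplified] intro: range_eqI[of _ _ c])
      qed
      then show "h (emb u) \<in> range emb" "h eta \<in> range (\<lambda>a. a *s eta)" by auto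
    qed
    have "\<forall>h\<in>?H. f \<circ> Phi h = Phi h \<circ> f"
      unfolding f(1) by (intro ballI x_op_Phi_commute f(2) stable)
    then show "f \<in> {\<phi>. clinear \<phi> \<and> (\<forall>h\<in>?H. \<phi> \<circ> Phi h = Phi h \<circ> \<phi>)}"
      by (simp add: f(1) clinear_x_op)
  }
qed

theorem theorem2p4:
  assumes "CARD('n :: finite) \<ge> CARD('r :: {finite, linorder})"
  shows "(D_alg_V :: (('n, 'r) tensor \<Rightarrow> ('n, 'r) tensor) set) = C_Psi
    \<and> (End_commuting enhanced_Gm :: (('n, 'r) tensor \<Rightarrow> ('n, 'r) tensor) set) = C_Psi"
proof (intro conjI equalityI subsetI)
  fix \<phi> :: "('n, 'r) tensor \<Rightarrow> ('n, 'r) tensor"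
  {
    assume "\<phi> \<in> D_alg_V"
    then have \<phi>: "\<phi> \<in> D_alg" "\<And>v. \<phi> \<circ> Phi (e_pow v) = Phi (e_pow v) \<circ> \<phi>"
      by (auto simp: D_alg_V_def)
    then have "clinear \<phi>"
      and comm: "\<And>h. h \<in> {enh g 0 | g. g \<in> carrier GL} \<union> Gm \<Longrightarrow> \<phi> \<circ> Phi h = Phi h \<circ> \<phi>"
      using D_alg_subset unfolding End_commuting_def by blast+
    \<comment> \<open>Membership in \<open>D_alg\<close> accounts for GL(V) and the scalings; the
      definition of \<open>D_alg_V\<close> adds the maps \<open>e_pow v\<close>.\<close>
    have "parabolic_equivariant \<phi>"
    proof (rule parabolic_equivariant.intro)
      show "\<phi> (Phi (enh g 0) t) = Phi (enh g 0) (\<phi> t)" if "g \<in> carrier GL" for g t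
        using fun_cong[OF comm[of "enh g 0"], of t] that by auto
      show "\<phi> (Phi (scale_eta c) t) = Phi (scale_eta c) (\<phi> t)" if "c \<noteq> 0" for c t
        using fun_cong[OF comm[of "scale_eta c"], of t] that by (auto simp: Gm_def)
      show "\<phi> (Phi (e_pow v) t) = Phi (e_pow v) (\<phi> t)" for v t
        using fun_cong[OF \<phi>(2), of v t] by simp
    qed fact
    then show "\<phi> \<in> C_Psi"
      using assms by (rule parabolic_equivariant_in_C_Psi)
  next
    assume C: "\<phi> \<in> C_Psi"
    have "e_pow v \<in> carrier GL" for v :: "complex ^ 'n"
      unfolding e_pow_def by (rule enh_in_GL) (simp add: mem_GL_iff clinear_iff)
    then have "range e_pow \<subseteq> {h :: complex ^ 'n option \<Rightarrow> _. clinear h}"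
      by (auto simp: mem_GL_iff)
    then have "\<phi> \<in> End_commuting (range e_pow)"
      using C C_Psi_subset by blast
    moreover have "\<phi> \<in> D_alg"
      using C unfolding C_Psi_def D_alg_def by (meson Un_upper1 hull_mono subsetD)
    ultimately show "\<phi> \<in> D_alg_V"
      by (auto simp: D_alg_V_def End_commuting_def)
  next
    assume "\<phi> \<in> End_commuting enhanced_Gm"
    then show "\<phi> \<in> C_Psi"
      using assms
      by (intro parabolic_equivariant_in_C_Psi commuting_imp_parabolic_equivariant)
        (auto simp: End_commuting_def)
  next
    assume "\<phi> \<in> C_Psi"
    then show "\<phi> \<in> End_commuting enhanced_Gm"
      using C_Psi_subset[OF enhanced_Gm_clinear] by blast
  }
qed

end
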